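(* Let $n$ be a positive integer, let $v\in Z_4^n$ be a column vector, and for $i=0,1,2,3$ let $f_i$ be the number of entries of $v$ equal to $i$. Let $D$ be the two-level $2^{2n}\times(2n+2)$ design generated by $G=(v,I_n)$, and let $D'$ be a half-fraction of $D$. (a) If $f_2>0$, $f_1+f_3>0$ and the branching column is associated with number 1 or 3, the projectivity of $D'$ is $2(f_1+f_3)$. (b) If $f_2=0$, $f_1+f_3>0$ and the branching column is associated with number 1 or 3, the projectivity of $D'$ is $2(f_1+f_3)-2$. (c) If $f_2>1$ and the branching column is associated with number 2, the projectivity of $D'$ is $2(f_1+f_3)+1$. (d) If $f_2=1$ and the branching column is associated with number 2, the projectivity of $D'$ is $2(f_1+f_3)$.
   Context: $Z_4=\{0,1,2,3\}$ is the ring of integers modulo 4, and $I_n$ is the $n\times n$ identity matrix. Design generated by $G=(v,I_n)$: let $C$ be the $2^{2n}\times(n+1)$ matrix whose rows are all linear combinations $uG$, $u\in Z_4^n$. Replace each entry of $C$ by a pair of $\pm1$ symbols via the Gray map $0\mapsto(1,1)$, $1\mapsto(1,-1)$, $2\mapsto(-1,-1)$, $3\mapsto(-1,1)$, so that column $j$ of $C$ becomes columns $2j-1,2j$. The result $D$ is a $2^{2n}\times(2n+2)$ matrix with entries $\pm1$ (a two-level design; rows are runs, columns are factors). A column of $D$ is associated with number $z\in\{0,1,2,3\}$ if it is one of the two columns of $D$ arising from the $i$th column of $I_n$ for some $i$ such that the $i$th entry of $v$ is $z$ (i.e. columns $2i+1,2i+2$ of $D$). Half-fraction: choose a column of $D$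 (the branching column), keep only the runs in which this column takes one fixed symbol ($+1$ or $-1$), and delete the branching column; this gives a $2^{2n-1}\times(2n+1)$ design $D'$. A two-level design has projectivity $p$ if for every set of $p$ columns, the projection of the design onto these columns contains all $2^p$ level combinations in $\{\pm1\}^p$ (possibly with repetitions). "The projectivity" of a design is the largest such $p$ (it is $0$ if some column is constant).
   Formalization: Part (d) is stated with the additional hypothesis f_1+f_3>0; when f_2=1 and f_1=f_3=0 the printed claim fails, since the projectivity of D' is then 1, not 0 (for example n=1, v=(2)). *)

theory Defs
  imports "HOL-Analysis.Analysis" "HOL-Library.Numeral_Type"
begin

record ('r, 'c) design =
  runs :: "'r set"
  factors :: "'c set"
  level :: "'r \<Rightarrow> 'c \<Rightarrow> int"

text \<open>The bound by \<open>card (factors D)\<close> excludes the vacuous case in which there is no set of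
  \<open>p\<close> factors at all. For \<open>p = 0\<close> the condition only says that there is a run.\<close>

definition has_projectivity :: "('r, 'c) design \<Rightarrow> nat \<Rightarrow> bool" where
  "has_projectivity D p \<longleftrightarrow>
     p \<le> card (factors D) \<and>
     (\<forall>S. S \<subseteq> factors D \<and> finite S \<and> card S = p \<longrightarrow>
       (\<forall>l. (\<forall>c\<in>S. l c \<in> {1, -1}) \<longrightarrow> (\<exists>r\<in>runs D. \<forall>c\<in>S. level D r c = l c)))"

definition projectivity :: "('r, 'c) design \<Rightarrow> nat" where
  "projectivity D = Max {p. has_projectivity D p}"

definition half_fraction :: "('r, 'c) design \<Rightarrow> 'c \<Rightarrow> int \<Rightarrow> ('r, 'c) design" where
  "half_fraction D b s =
     \<lparr>runs = {r \<in> runs D. level D r b = s}, factors = factors D - {b}, level = level D\<rparr>"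

text \<open>The numeral type \<open>4\<close> is the ring of integers modulo 4. The type \<open>'n\<close> indexes the columns
  of the identity matrix, so \<open>n = CARD('n)\<close>; in \<open>gen_matrix v\<close> the index \<open>None\<close> is the leading
  column \<open>v\<close> and \<open>Some j\<close> is the column \<open>j\<close> of the identity matrix.\<close>

definition gen_matrix :: "4 ^ 'n \<Rightarrow> 4 ^ ('n option) ^ 'n" where
  "gen_matrix v = (\<chi> i j. case j of None \<Rightarrow> v $ i | Some k \<Rightarrow> mat 1 $ i $ k)"

definition gray :: "4 \<Rightarrow> int \<times> int" where
  "gray x = (if x = 0 then (1, 1) else if x = 1 then (1, -1) else if x = 2 then (-1, -1)
             else (-1, 1))"

datatype gray_pos = First | Second

instance gray_pos :: finite
proof
  have "(UNIV :: gray_pos set) \<subseteq> {First, Second}"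
    using gray_pos.exhaust by blast
  then show "finite (UNIV :: gray_pos set)"
    by (rule finite_subset) simp
qed

fun gray_symbol :: "gray_pos \<Rightarrow> 4 \<Rightarrow> int" where
  "gray_symbol First x = fst (gray x)"
| "gray_symbol Second x = snd (gray x)"

text \<open>The runs are indexed by the coefficient vectors \<open>u\<close> of the linear combinations \<open>u G\<close>, so
  repeated rows are counted with multiplicity; every column of \<open>C\<close> gives two factors.\<close>

definition generated_design :: "4 ^ 'm ^ 'n \<Rightarrow> (4 ^ 'n, 'm \<times> gray_pos) design" where
  "generated_design G =
     \<lparr>runs = UNIV, factors = UNIV, level = (\<lambda>u (j, h). gray_symbol h ((u v* G) $ j))\<rparr>"

definition associated :: "4 ^ 'n \<Rightarrow> 'n option \<times> gray_pos \<Rightarrow> 4 \<Rightarrow> bool" where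
  "associated v c z \<longleftrightarrow> (\<exists>i h. c = (Some i, h) \<and> v $ i = z)"

definition freq :: "4 ^ 'n \<Rightarrow> 4 \<Rightarrow> nat" where
  "freq v z = card {i. v $ i = z}"

end

theory Submission
  imports Defs
begin

text \<open>
  The two factors of a column of \<open>I\<^sub>n\<close> determine \<open>u\<^sub>i\<close> bijectively, so levels on such factors can
  be prescribed freely, and everything depends on which values \<open>w = \<Sum>\<^sub>i u\<^sub>i v\<^sub>i\<close> can still take.
  Fixing one symbol of \<open>u\<^sub>i\<close> leaves two adjacent values, so with \<open>k\<close> free factors in columns where
  \<open>v\<^sub>i\<close> is a unit, \<open>w\<close> ranges at least over \<open>c, c + 1, \<dots>, c + k\<close>; a free factor where \<open>v\<^sub>i = 2\<close>
  additionally allows to add 2. Three consecutive values realise both levels of either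
  leading factor, four realise all pairs of levels; counting gives the lower bounds.

  Two sets of factors attain the bounds. Both leading factors together with all factors in unit
  columns are dependent, as either part alone determines \<open>w\<close> modulo 2. If instead all but one of
  the factors with \<open>v\<^sub>i \<noteq> 0\<close> are fixed (the branching factor included), the levels can be chosen
  such that \<open>w = u\<^sub>k v\<^sub>k\<close> with \<open>v\<^sub>k\<close> a unit, and then one leading factor copies the fixed factor of
  column \<open>k\<close>.
\<close>


section \<open>Arithmetic of the Gray map on the integers modulo 4\<close>

lemma Z4_cases: "(x::4) = 0 \<or> x = 1 \<or> x = 2 \<or> x = 3"
  using exhaust_4[of x] by auto

lemma ex_Z4: "(\<exists>x::4. P x) \<longleftrightarrow> P 0 \<or> P 1 \<or> P 2 \<or> P 3"
  using Z4_cases by metis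

lemma UNIV_gray_pos: "UNIV = {First, Second}"
  using gray_pos.exhaust by blast

lemma card_gray_pos: "CARD(gray_pos) = 2"
  by (simp add: UNIV_gray_pos)

lemma all_gray_pos: "(\<forall>h. P h) \<longleftrightarrow> P First \<and> P Second"
  using gray_pos.exhaust by metis

lemma gray_pos_subset_cases: "H = {} \<or> H = {First} \<or> H = {Second} \<or> H = (UNIV :: gray_pos set)"
proof -
  have "H \<in> Pow {First, Second}"
    using UNIV_gray_pos by auto
  then show ?thesis
    unfolding UNIV_gray_pos Pow_insert by auto
qed

text \<open>Each level of a single Gray symbol is taken on two cyclically adjacent elements:
  \<open>{0, 1}\<close> and \<open>{2, 3}\<close> for \<open>First\<close>, \<open>{3, 0}\<close>
  and \<open>{1, 2}\<close> for \<open>Second\<close>.\<close>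

lemma gray_adjacent:
  "t \<in> {1, -1} \<Longrightarrow> \<exists>x. gray_symbol h x = t \<and> gray_symbol h (x + 1) = t"
  by (cases h) (auto simp: ex_Z4 gray_def)

lemma gray_surj:
  "s \<in> {1, -1} \<Longrightarrow> t \<in> {1, -1} \<Longrightarrow> \<exists>x. gray_symbol First x = s \<and> gray_symbol Second x = t"
  by (auto simp: ex_Z4 gray_def)

text \<open>\<open>H\<close> is the set of symbols fixed in one unit column. Fixing both symbols
  leaves one value, fixing one leaves two adjacent values, fixing none leaves everything; a unit
  factor is 1 or -1 and at most reverses the order. The length is measured by the number of free
  symbols, since this is what adds up over columns.\<close>

lemma gray_progression:
  assumes z: "z \<in> {1, 3}" and t: "\<And>h. h \<in> H \<Longrightarrow> t h \<in> {1, -1}"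
  shows "\<exists>c. \<forall>j\<le>card (- H). \<exists>x. (\<forall>h\<in>H. gray_symbol h x = t h) \<and> x * z = c + of_nat j"
proof -
  have single: ?thesis if "H = {h}" for h
  proof -
    have "{First, Second} - {h} = {if h = First then Second else First}"
      by (cases h) auto
    then have card: "card (- H) = 1"
      using \<open>H = {h}\<close> by (simp add: Compl_eq_Diff_UNIV UNIV_gray_pos)
    obtain x where x: "gray_symbol h x = t h" "gray_symbol h (x + 1) = t h"
      using gray_adjacent t \<open>H = {h}\<close> by blast
    \<comment> \<open>For \<open>z = 3 = -1\<close> the two values are traversed backwards, so the
      progression starts at the image of \<open>x + 1\<close>.\<close>
    have "\<exists>c. {c, c + 1} \<subseteq> {x * z, (x + 1) * z}"
    proof (cases "z = 1")
      case False
      then have "(x + 1) * z + 1 = x * z"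
        using z by (simp add: algebra_simps)
      then show ?thesis by (intro exI[of _ "(x + 1) * z"]) simp
    qed auto
    then obtain c where c: "c \<in> {x * z, (x + 1) * z}" "c + 1 \<in> {x * z, (x + 1) * z}"
      by blast
    have "\<exists>y. (\<forall>h\<in>H. gray_symbol h y = t h) \<and> y * z = w" if "w \<in> {x * z, (x + 1) * z}" for w
      using that x \<open>H = {h}\<close> by blast
    from this[OF c(1)] this[OF c(2)] show ?thesis
      unfolding card by (intro exI[of _ c]) (simp add: le_Suc_eq)
  qed
  \<comment> \<open>A unit is its own inverse here, so with no symbol fixed
    \<open>x = of_nat j * z\<close> yields \<open>x * z = of_nat j\<close>.\<close>
  have "z * z = 1"
    using z by auto
  then have "H = {} \<Longrightarrow> ?thesis"
    by (intro exI[of _ 0] allI impI exI[of _ "of_nat _ * z"]) (simp add: mult.assoc)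
  moreover have "H = UNIV \<Longrightarrow> ?thesis"
    using gray_surj[of "t First" "t Second"] t
    by (simp add: all_gray_pos)
  ultimately show ?thesis
    using gray_pos_subset_cases[of H] single by blast
qed

lemma gray_fibre_nonempty:
  assumes "\<And>h. h \<in> H \<Longrightarrow> t h \<in> {1, -1}"
  shows "\<exists>x. \<forall>h\<in>H. gray_symbol h x = t h"
proof -
  obtain c where "\<forall>j\<le>card (- H). \<exists>x. (\<forall>h\<in>H. gray_symbol h x = t h) \<and> x * 1 = c + of_nat j"
    using gray_progression[of 1 H t] assms by blast
  then show ?thesis
    using le0 by blast
qed

text \<open>One of the neighbours \<open>x + 1\<close>, \<open>x - 1\<close> differs from
  \<open>x\<close> in symbol \<open>h\<close> only, and either neighbour changes the double by 2
  modulo 4.\<close>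

lemma gray_toggle:
  "\<exists>y. (\<forall>h'. h' \<noteq> h \<longrightarrow> gray_symbol h' y = gray_symbol h' x) \<and> y * 2 = x * 2 + 2"
  using Z4_cases[of x] by (cases h) (auto simp: ex_Z4 all_gray_pos gray_def)

text \<open>Negation modulo 4 swaps the two Gray symbols.\<close>

lemma gray_symbol_mult_unit:
  assumes "z \<in> {1, 3}"
  shows "\<exists>h'. \<forall>x. gray_symbol h' (x * z) = gray_symbol h x"
proof (cases "z = 1")
  case False
  then have z: "z = 3"
    using assms by simp
  have "gray_symbol First (x * 3) = gray_symbol Second x" for x
    using Z4_cases[of x] by (elim disjE) (simp_all add: gray_def)
  moreover have "gray_symbol Second (x * 3) = gray_symbol First x" for x
    using Z4_cases[of x] by (elim disjE) (simp_all add: gray_def)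
  ultimately show ?thesis
    unfolding z by (cases h) blast+
qed auto

section \<open>Values of the leading entry under prescribed levels\<close>

text \<open>These are the entries of the leading column over all runs with levels \<open>l\<close>
  on the factors \<open>F\<close> of the identity columns. Levels on the leading factors thereby
  become conditions on a single element of the ring.\<close>

definition reachable :: "4 ^ 'n \<Rightarrow> ('n \<times> gray_pos) set \<Rightarrow> ('n \<times> gray_pos \<Rightarrow> int) \<Rightarrow> 4 set" where
  "reachable v F l =
     {\<Sum>i\<in>UNIV. u $ i * v $ i |u. \<forall>(i, h)\<in>F. gray_symbol h (u $ i) = l (i, h)}"

abbreviation unit_cols :: "4 ^ 'n \<Rightarrow> ('n \<times> gray_pos) set" where
  "unit_cols v \<equiv> {i. v $ i \<in> {1, 3}} \<times> UNIV"

abbreviation two_cols :: "4 ^ 'n \<Rightarrow> ('n \<times> gray_pos) set" where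
  "two_cols v \<equiv> {i. v $ i = 2} \<times> UNIV"

text \<open>Progressions with common difference 1 add to such a progression, and their lengths
  \<open>k i\<close> add as well.\<close>

lemma sum_progressions:
  fixes c :: "'i \<Rightarrow> 'a::semiring_1"
  assumes "finite A"
    and "\<And>i j. i \<in> A \<Longrightarrow> j \<le> k i \<Longrightarrow> \<exists>x. P i x \<and> f i x = c i + of_nat j"
    and "j \<le> sum k A"
  shows "\<exists>u. (\<forall>i\<in>A. P i (u i)) \<and> (\<Sum>i\<in>A. f i (u i)) = sum c A + of_nat j"
  using assms
proof (induction A arbitrary: j rule: finite_induct)
  case empty
  then show ?case by simp
next
  case (insert a A)
  \<comment> \<open>The split is greedy: the progression of \<open>a\<close> absorbs as much of
    \<open>j\<close> as it can.\<close>
  obtain j1 j2 where j: "j = j1 + j2" "j1 \<le> k a" "j2 \<le> sum k A"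
  proof (cases "j \<le> k a")
    case True
    then show ?thesis using that[of j 0] by simp
  next
    case False
    then show ?thesis using that[of "k a" "j - k a"] insert by simp
  qed
  obtain x where x: "P a x" "f a x = c a + of_nat j1"
    using insert.prems j by blast
  obtain u where u: "\<forall>i\<in>A. P i (u i)" "(\<Sum>i\<in>A. f i (u i)) = sum c A + of_nat j2"
    using insert.IH[of j2] insert.prems j by blast
  have "(\<Sum>i\<in>A. f i ((u(a := x)) i)) = (\<Sum>i\<in>A. f i (u i))"
    using insert.hyps by (intro sum.cong) auto
  then show ?case
    using insert.hyps x u j by (intro exI[of _ "u(a := x)"]) (auto simp: algebra_simps)
qed

text \<open>The coordinates of \<open>u\<close> are chosen independently, so the progressions of the
  unit columns add, and every free factor in a unit column lengthens the result by one.\<close>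

lemma reachable_progression:
  assumes l: "\<And>c. c \<in> F \<Longrightarrow> l c \<in> {1, -1}"
  shows "\<exists>c. \<forall>j\<le>card (unit_cols v - F). c + of_nat j \<in> reachable v F l"
proof -
  \<comment> \<open>Outside the unit columns the length is 0: one admissible value is chosen and
    kept.\<close>
  define k where "k i = (if v $ i \<in> {1, 3} then card (- {h. (i, h) \<in> F}) else 0)" for i
  define P where "P i x \<longleftrightarrow> (\<forall>h. (i, h) \<in> F \<longrightarrow> gray_symbol h x = l (i, h))" for i x
  have "\<exists>c. \<forall>j\<le>k i. \<exists>x. P i x \<and> x * v $ i = c + of_nat j" for i
  proof (cases "v $ i \<in> {1, 3}")
    case True
    then show ?thesis
      using gray_progression[of "v $ i" "{h. (i, h) \<in> F}" "\<lambda>h. l (i, h)"] l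
      by (simp add: k_def P_def)
  next
    case False
    then have "k i = 0"
      by (auto simp: k_def)
    moreover obtain x where "P i x"
      using gray_fibre_nonempty[of "{h. (i, h) \<in> F}" "\<lambda>h. l (i, h)"] l
      by (auto simp: P_def)
    ultimately show ?thesis
      by auto
  qed
  then obtain c where c: "\<And>i j. j \<le> k i \<Longrightarrow> \<exists>x. P i x \<and> x * v $ i = c i + of_nat j"
    by metis
  have "unit_cols v - F = (SIGMA i:{i. v $ i \<in> {1, 3}}. - {h. (i, h) \<in> F})"
    by auto
  also have "card \<dots> = sum k UNIV"
    by (simp add: k_def sum.If_cases flip: sum.inter_restrict)
  finally have card: "card (unit_cols v - F) = sum k UNIV" .
  have "sum c UNIV + of_nat j \<in> reachable v F l" if "j \<le> sum k UNIV" for j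
  proof -
    obtain u where "\<forall>i. P i (u i)" "(\<Sum>i\<in>UNIV. u i * v $ i) = sum c UNIV + of_nat j"
      using sum_progressions[of UNIV k P "\<lambda>i x. x * v $ i" c j] c \<open>j \<le> sum k UNIV\<close> by auto
    then show ?thesis
      unfolding reachable_def by (intro CollectI exI[of _ "\<chi> i. u i"]) (auto simp: P_def)
  qed
  then show ?thesis
    using card by metis
qed

text \<open>Toggling a free symbol in a column with entry 2 leaves all prescribed levels intact and
  moves the sum by 2.\<close>

lemma reachable_add_2:
  assumes free: "\<not> two_cols v \<subseteq> F" and w: "w \<in> reachable v F l"
  shows "w + 2 \<in> reachable v F l"
proof -
  obtain i h where ih: "v $ i = 2" "(i, h) \<notin> F"
    using free by auto
  obtain u where u: "w = (\<Sum>i\<in>UNIV. u $ i * v $ i)"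
      "\<forall>(i, h)\<in>F. gray_symbol h (u $ i) = l (i, h)"
    using w by (auto simp: reachable_def)
  obtain y where y: "\<forall>h'. h' \<noteq> h \<longrightarrow> gray_symbol h' y = gray_symbol h' (u $ i)"
      "y * 2 = u $ i * 2 + 2"
    using gray_toggle by blast
  define u' where "u' = (\<chi> j. if j = i then y else u $ j)"
  have "(\<Sum>j\<in>UNIV. u' $ j * v $ j) = u' $ i * v $ i + (\<Sum>j\<in>UNIV - {i}. u' $ j * v $ j)"
    by (simp add: sum.remove)
  also have "(\<Sum>j\<in>UNIV - {i}. u' $ j * v $ j) = (\<Sum>j\<in>UNIV - {i}. u $ j * v $ j)"
    by (intro sum.cong) (auto simp: u'_def)
  also have "u' $ i * v $ i = u $ i * v $ i + 2"
    using y ih by (simp add: u'_def)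
  also have "u $ i * v $ i + 2 + (\<Sum>j\<in>UNIV - {i}. u $ j * v $ j) = w + 2"
    unfolding u by (simp add: sum.remove[of UNIV i] algebra_simps)
  finally have "(\<Sum>j\<in>UNIV. u' $ j * v $ j) = w + 2" .
  moreover have "\<forall>(j, h')\<in>F. gray_symbol h' (u' $ j) = l (j, h')"
  proof (intro ballI, clarify)
    fix j h'
    assume jh: "(j, h') \<in> F"
    then have "gray_symbol h' (u' $ j) = gray_symbol h' (u $ j)"
      using y ih by (auto simp: u'_def)
    then show "gray_symbol h' (u' $ j) = l (j, h')"
      using u jh by auto
  qed
  ultimately show ?thesis
    unfolding reachable_def by (intro CollectI exI[of _ u']) auto
qed

text \<open>Either the progression already has four terms, or it contains \<open>c\<close> and
  \<open>c + 1\<close>, and adding 2 to these gives the other two values.\<close>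

lemma reachable_UNIV:
  assumes l: "\<And>c. c \<in> F \<Longrightarrow> l c \<in> {1, -1}"
    and free: "3 \<le> card (unit_cols v - F) \<or> \<not> two_cols v \<subseteq> F \<and> \<not> unit_cols v \<subseteq> F"
  shows "w \<in> reachable v F l"
proof -
  obtain c where c: "\<forall>j\<le>card (unit_cols v - F). c + of_nat j \<in> reachable v F l"
    using reachable_progression[of F l v] l by blast
  have "w \<in> {c, c + 1, c + 2, c + 3}"
    using Z4_cases[of "w - c"] by (auto simp: diff_eq_eq add.commute)
  from free have "{c, c + 1, c + 2, c + 3} \<subseteq> reachable v F l"
  proof
    assume "3 \<le> card (unit_cols v - F)"
    then have "c + of_nat j \<in> reachable v F l" if "j \<le> 3" for j
      using c that by auto
    from this[of 0] this[of 1] this[of 2] this[of 3] show ?thesis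
      by simp
  next
    assume free: "\<not> two_cols v \<subseteq> F \<and> \<not> unit_cols v \<subseteq> F"
    then have "unit_cols v - F \<noteq> {}"
      by blast
    then have "1 \<le> card (unit_cols v - F)"
      by (simp add: Suc_le_eq card_gt_0_iff del: Diff_eq_empty_iff)
    then have "c \<in> reachable v F l" "c + 1 \<in> reachable v F l"
      using c[rule_format, of 0] c[rule_format, of 1] by simp_all
    then show ?thesis
      using reachable_add_2[of v F c l] reachable_add_2[of v F "c + 1" l] free
      by (simp add: add.assoc)
  qed
  then show ?thesis
    using \<open>w \<in> {c, c + 1, c + 2, c + 3}\<close> by blast
qed

text \<open>Elements differing by 2 have opposite levels in both Gray symbols, so reaching
  \<open>c\<close> and \<open>c + 2\<close> is enough.\<close>

lemma reachable_symbol: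
  assumes l: "\<And>c. c \<in> F \<Longrightarrow> l c \<in> {1, -1}"
    and free: "2 \<le> card (unit_cols v - F) \<or> \<not> two_cols v \<subseteq> F"
    and t: "t \<in> {1, -1}"
  shows "\<exists>w\<in>reachable v F l. gray_symbol h w = t"
proof -
  obtain c where c: "\<forall>j\<le>card (unit_cols v - F). c + of_nat j \<in> reachable v F l"
    using reachable_progression[of F l v] l by blast
  from free have "c + 2 \<in> reachable v F l"
    using c[rule_format, of 0] c[rule_format, of 2] reachable_add_2[of v F c l] by auto
  moreover have "c \<in> reachable v F l"
    using c[rule_format, of 0] by simp
  moreover have "gray_symbol h c = t \<or> gray_symbol h (c + 2) = t"
    using t Z4_cases[of c] by (cases h) (auto simp: gray_def)
  ultimately show ?thesis
    by blast
qed

section \<open>General facts on projectivity\<close>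

lemma has_projectivity_antimono:
  fixes D :: "('r, 'c) design"
  assumes fin: "finite (factors D)" and p: "has_projectivity D p" and "q \<le> p"
  shows "has_projectivity D q"
  unfolding has_projectivity_def
proof (intro conjI allI impI)
  show "q \<le> card (factors D)"
    using p \<open>q \<le> p\<close> by (simp add: has_projectivity_def)
next
  fix S and l :: "'c \<Rightarrow> int"
  assume S: "S \<subseteq> factors D \<and> finite S \<and> card S = q" and l: "\<forall>c\<in>S. l c \<in> {1, -1}"
  obtain T where T: "S \<subseteq> T" "T \<subseteq> factors D" "card T = p"
    using exists_subset_between[of S p "factors D"] S p fin \<open>q \<le> p\<close>
    by (auto simp: has_projectivity_def)
  \<comment> \<open>The added factors receive the arbitrary level 1.\<close>
  have "\<forall>c\<in>T. (if c \<in> S then l c else 1) \<in> {1, -1}"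
    using l by simp
  moreover have "finite T"
    using T fin finite_subset by blast
  ultimately obtain r where "r \<in> runs D" "\<forall>c\<in>T. level D r c = (if c \<in> S then l c else 1)"
    using p T unfolding has_projectivity_def
    by (elim conjE allE[of _ T]) (auto elim!: allE[of _ "\<lambda>c. if c \<in> S then l c else 1"])
  then show "\<exists>r\<in>runs D. \<forall>c\<in>S. level D r c = l c"
    using T by (metis subsetD)
qed

lemma projectivity_eqI:
  assumes fin: "finite (factors D)" and p: "has_projectivity D p"
    and Suc: "\<not> has_projectivity D (Suc p)"
  shows "projectivity D = p"
  unfolding projectivity_def
proof (rule Max_eqI)
  show "finite {p. has_projectivity D p}"
    by (rule finite_subset[of _ "{..card (factors D)}"]) (auto simp: has_projectivity_def)
  show "q \<le> p" if "q \<in> {p. has_projectivity D p}" for q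
    using has_projectivity_antimono[OF fin _, of q "Suc p"] that Suc by force
qed (use p in simp)

section \<open>Lower bounds for half-fractions\<close>

lemma level_generated:
  "level (generated_design (gen_matrix v)) u (None, h) = gray_symbol h (\<Sum>i\<in>UNIV. u $ i * v $ i)"
  "level (generated_design (gen_matrix v)) u (Some i, h) = gray_symbol h (u $ i)"
  by (simp_all add: generated_design_def gen_matrix_def vector_matrix_mult_def mat_def
      if_distrib cong: if_cong)

text \<open>The bound \<open>p\<close> ensures enough free unit factors when all factors in columns
  with entry 2 are fixed. The bound \<open>two\<close> ensures one free unit factor when some factor
  in such a column is free; it is larger by 1 if the branching factor itself lies in such a column,
  as it then fixes no unit factor.\<close>

lemma has_projectivity_half_fraction:
  fixes v :: "4 ^ 'n"
  assumes s: "s \<in> {1, -1}"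
    and b: "(i, h) \<in> unit_cols v \<union> two_cols v"
    and p: "p + 2 \<le> card (unit_cols v) + card (two_cols v)"
    and two: "two_cols v = {} \<or>
      p \<le> card (unit_cols v) + (if (i, h) \<in> two_cols v then 1 else 0)"
  shows "has_projectivity (half_fraction (generated_design (gen_matrix v)) (Some i, h) s) p"
    (is "has_projectivity ?D p")
proof -
  let ?U = "unit_cols v" and ?T = "two_cols v"
  let ?some = "\<lambda>(i, h). (Some i, h) :: 'n option \<times> gray_pos"
  have disj: "?U \<inter> ?T = {}"
    by auto
  have "card ?U + card ?T = card (?U \<union> ?T)"
    using disj by (simp add: card_Un_disjoint)
  also have "\<dots> \<le> card (UNIV :: ('n \<times> gray_pos) set)"
    by (rule card_mono) auto
  also have "\<dots> = 2 * CARD('n)"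
    by (simp add: card_gray_pos)
  finally have "p \<le> 2 * CARD('n)"
    using p by simp
  moreover have "card (factors ?D) = 2 * CARD('n) + 1"
    by (simp add: half_fraction_def generated_design_def card_Diff_subset card_gray_pos
        card_UNIV_option)
  ultimately have "p \<le> card (factors ?D)"
    by simp
  moreover have "\<exists>r\<in>runs ?D. \<forall>c\<in>S. level ?D r c = l c"
    if S: "S \<subseteq> factors ?D" "card S = p" and l: "\<forall>c\<in>S. l c \<in> {1, -1}" for S l
  proof -
    \<comment> \<open>The branching factor counts as a fixed factor with level \<open>s\<close>,
      although it is not in \<open>S\<close>. Hence the off-by-one
      \<open>card N + card F = Suc p\<close> below.\<close>
    define F where "F = {c. ?some c \<in> insert (Some i, h) S}"
    define N where "N = {h. (None, h) \<in> S}"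
    define l' where "l' c = (if c = (i, h) then s else l (?some c))" for c
    have bS: "(Some i, h) \<notin> S"
      using S by (auto simp: half_fraction_def)
    have bF: "(i, h) \<in> F"
      by (simp add: F_def)
    have l': "l' c \<in> {1, -1}" if "c \<in> F" for c
      using that l s by (cases c) (auto simp: F_def l'_def)
    have run: ?thesis
      if w: "w \<in> reachable v F l'" and sym: "\<And>h. h \<in> N \<Longrightarrow> gray_symbol h w = l (None, h)" for w
    proof -
      obtain u where u: "w = (\<Sum>i\<in>UNIV. u $ i * v $ i)"
          "\<forall>(j, k)\<in>F. gray_symbol k (u $ j) = l' (j, k)"
        using w by (auto simp: reachable_def)
      have "gray_symbol h (u $ i) = s"
        using u bF by (auto simp: l'_def)
      then have "u \<in> runs ?D"
        by (simp add: half_fraction_def level_generated) (simp add: generated_design_def)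
      moreover have "level ?D u (a, k) = l (a, k)" if ak: "(a, k) \<in> S" for a k
      proof (cases a)
        case None
        then show ?thesis
          using ak sym u by (simp add: half_fraction_def level_generated N_def)
      next
        case (Some j)
        then have "(j, k) \<in> F" "(j, k) \<noteq> (i, h)"
          using ak bS by (auto simp: F_def)
        then have "gray_symbol k (u $ j) = l (Some j, k)"
          using u by (auto simp: l'_def)
        then show ?thesis
          using Some by (simp add: half_fraction_def level_generated)
      qed
      ultimately show ?thesis
        by (intro bexI[of _ u] ballI) (auto simp del: insert_iff)
    qed
    have "insert (Some i, h) S = Pair None ` N \<union> ?some ` F"
    proof (intro set_eqI iffI)
      fix c assume "c \<in> insert (Some i, h) S"
      then show "c \<in> Pair None ` N \<union> ?some ` F"
        by (cases c; cases "fst c") (auto simp: N_def F_def image_iff)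
    qed (auto simp: N_def F_def)
    then have "Suc p = card (Pair None ` N \<union> ?some ` F)"
      using bS S by (metis card_insert_disjoint finite)
    also have "\<dots> = card (Pair (None :: 'n option) ` N) + card (?some ` F)"
      by (intro card_Un_disjoint) auto
    also have "\<dots> = card N + card F"
      by (simp add: card_image inj_on_def split_beta prod_eq_iff)
    finally have cards: "card N + card F = Suc p"
      by simp
    have UTF: "card (?U \<inter> F) + card (?T \<inter> F) \<le> card F"
    proof -
      have "card (?U \<inter> F) + card (?T \<inter> F) = card ((?U \<union> ?T) \<inter> F)"
        using disj by (subst card_Un_disjoint[symmetric]) (auto simp: Int_Un_distrib2)
      then show ?thesis
        using card_mono[of F "(?U \<union> ?T) \<inter> F"] by simp
    qed
    have diff: "card (?U - F) = card ?U - card (?U \<inter> F)" "card (?U \<inter> F) \<le> card ?U"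
      by (rule card_Diff_subset_Int, simp) (rule card_mono, simp, blast)
    have TF: "card (?T \<inter> F) = card ?T" if "?T \<subseteq> F"
      using that by (simp add: Int_absorb2)
    consider "N = {}" | k where "N = {k}" | "N = UNIV"
      using gray_pos_subset_cases[of N] by blast
    then show ?thesis
    proof cases
      case 1
      obtain c where c: "\<forall>j\<le>card (?U - F). c + of_nat j \<in> reachable v F l'"
        using reachable_progression[of F l' v] l' by blast
      show ?thesis
        by (rule run[of c]) (use 1 c[rule_format, of 0] in auto)
    next
      case 2
      \<comment> \<open>Here \<open>card F = p\<close>. If \<open>F\<close> contains
        \<open>?T\<close>, at most \<open>p - card ?T\<close> of its factors lie in
        \<open>?U\<close>, which leaves at least 2 unit factors free.\<close>
      then have "2 \<le> card (?U - F) \<or> \<not> ?T \<subseteq> F"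
        using cards UTF diff TF p by (cases "?T \<subseteq> F") (simp_all del: card_cartesian_product)
      moreover have "l (None, k) \<in> {1, -1}"
        using 2 l by (auto simp: N_def)
      ultimately obtain w where "w \<in> reachable v F l'" "gray_symbol k w = l (None, k)"
        using reachable_symbol[of F l' v "l (None, k)" k] l' by blast
      then show ?thesis
        using 2 by (intro run[of w]) auto
    next
      case 3
      then have "card N = 2"
        by (simp add: UNIV_gray_pos)
      then have "card F = p - 1" "p > 0"
        using cards bF card_gt_0_iff[of F] by auto
      have "3 \<le> card (?U - F) \<or> \<not> ?T \<subseteq> F \<and> \<not> ?U \<subseteq> F"
      proof (cases "?T \<subseteq> F")
        case True
        then show ?thesis
          using \<open>card F = p - 1\<close> \<open>p > 0\<close> UTF diff TF p by linarith
      next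
        case False
        then have "p \<le> card ?U + (if (i, h) \<in> ?T then 1 else 0)"
          using two by auto
        \<comment> \<open>A branching factor in \<open>?T\<close> takes up one of the
          \<open>p - 1\<close> elements of \<open>F\<close>, so the rest cannot exhaust
          \<open>?U\<close>.\<close>
        moreover have "card (?T \<inter> F) \<ge> (if (i, h) \<in> ?T then 1 else 0)"
          using bF by (auto simp: Suc_le_eq card_gt_0_iff)
        ultimately have "card (?U \<inter> F) < card ?U"
          using \<open>card F = p - 1\<close> \<open>p > 0\<close> UTF by linarith
        then show ?thesis
          using False by (auto simp: Int_absorb2)
      qed
      moreover have "l (None, k) \<in> {1, -1}" for k
        using 3 l by (auto simp: N_def)
      then obtain w where "gray_symbol First w = l (None, First)"
          "gray_symbol Second w = l (None, Second)"
        using gray_surj by blast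
      ultimately show ?thesis
        using reachable_UNIV[of F l' v w] l' all_gray_pos[of "\<lambda>k. gray_symbol k w = l (None, k)"]
        by (intro run[of w]) auto
    qed
  qed
  ultimately show ?thesis
    unfolding has_projectivity_def by blast
qed

section \<open>Dependent sets of factors: upper bounds\<close>

lemma not_has_projectivityI:
  assumes "S \<subseteq> factors D" "finite S" "card S = p" "\<And>c. c \<in> S \<Longrightarrow> l c \<in> {1, -1}"
    and "\<And>r. r \<in> runs D \<Longrightarrow> \<forall>c\<in>S. level D r c = l c \<Longrightarrow> False"
  shows "\<not> has_projectivity D p"
  using assms unfolding has_projectivity_def by blast

text \<open>An element is even exactly if its two Gray symbols agree. Equal symbols in every unit
  column make all terms of the sum even, whereas the levels 1 and -1 on the leading factors demand
  an odd sum.\<close>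

lemma not_has_projectivity_parity:
  fixes v :: "4 ^ 'n"
  assumes s: "s \<in> {1, -1}"
  shows "\<not> has_projectivity (half_fraction (generated_design (gen_matrix v)) (Some i, h) s)
           (card (unit_cols v - {(i, h)}) + 2)"
    (is "\<not> has_projectivity ?D _")
proof -
  let ?some = "\<lambda>(i, h). (Some i, h) :: 'n option \<times> gray_pos"
  let ?U' = "unit_cols v - {(i, h)}"
  \<comment> \<open>Column \<open>i\<close> uses \<open>s\<close> so that its remaining symbol
    agrees with the branching symbol if \<open>i\<close> is a unit column.\<close>
  let ?l = "\<lambda>c. if fst c = Some i then s else if c = (None, Second) then -1 else 1"
  show ?thesis
  proof (rule not_has_projectivityI[where S = "range (Pair None) \<union> ?some ` ?U'" and l = ?l])
    show "range (Pair None) \<union> ?some ` ?U' \<subseteq> factors ?D"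
      by (auto simp: half_fraction_def generated_design_def)
    have "card (range (Pair None) \<union> ?some ` ?U')
        = card (range (Pair None :: gray_pos \<Rightarrow> 'n option \<times> gray_pos)) + card (?some ` ?U')"
      by (intro card_Un_disjoint) auto
    also have "\<dots> = 2 + card ?U'"
      by (simp add: card_image inj_on_def split_beta prod_eq_iff card_gray_pos)
    finally show "card (range (Pair None) \<union> ?some ` ?U') = card ?U' + 2"
      by simp
  next
    fix r assume "r \<in> runs ?D" and r: "\<forall>c\<in>range (Pair None) \<union> ?some ` ?U'. level ?D r c = ?l c"
    then have "gray_symbol h (r $ i) = s"
      by (simp add: half_fraction_def level_generated)
    moreover have "gray_symbol k (r $ j) = ?l (Some j, k)" if "(j, k) \<in> ?U'" for j k
      using bspec[OF r, of "(Some j, k)"] that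
      by (force simp: half_fraction_def level_generated)
    ultimately have unit: "gray_symbol k (r $ j) = (if j = i then s else 1)"
      if "v $ j \<in> {1, 3}" for j k
      using that by (cases "(j, k) = (i, h)") auto
    have even: "r $ j * v $ j \<in> {0, 2}" for j
    proof (cases "v $ j \<in> {1, 3}")
      case True
      then have "gray_symbol First (r $ j) = gray_symbol Second (r $ j)"
        using unit[OF True] by metis
      then have "r $ j \<in> {0, 2}"
        using Z4_cases[of "r $ j"] by (auto simp: gray_def)
      then show ?thesis
        using True by auto
    next
      case False
      then have "v $ j \<in> {0, 2}"
        using Z4_cases[of "v $ j"] by auto
      then show ?thesis
        using Z4_cases[of "r $ j"] by auto
    qed
    have "(\<Sum>j\<in>A. r $ j * v $ j) \<in> {0, 2}" if "finite A" for A
      using that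
    proof (induction A rule: finite_induct)
      case (insert a A)
      then have "r $ a * v $ a \<in> {0, 2}" "(\<Sum>j\<in>A. r $ j * v $ j) \<in> {0, 2}"
        using even by blast+
      then show ?case
        using insert.hyps by auto
    qed simp
    then have "(\<Sum>j\<in>UNIV. r $ j * v $ j) \<in> {0, 2}"
      by simp
    moreover have "gray_symbol First (\<Sum>j\<in>UNIV. r $ j * v $ j) = 1"
        "gray_symbol Second (\<Sum>j\<in>UNIV. r $ j * v $ j) = -1"
      using bspec[OF r, of "(None, First)"] bspec[OF r, of "(None, Second)"]
      by (simp_all add: half_fraction_def level_generated)
    ultimately show False
      by (auto simp: gray_def)
  qed (use s in auto)
qed

text \<open>The levels are 1 except that row \<open>i\<close> gets \<open>s\<close> throughout: a row with two equal symbols has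
  \<open>u\<^sub>j \<in> {0, 2}\<close>, and \<open>u\<^sub>j = 0\<close> if they are 1, so all terms but the \<open>k\<close>-th vanish.\<close>

lemma not_has_projectivity_aligned:
  fixes v :: "4 ^ 'n"
  assumes s: "s \<in> {1, -1}"
    and k: "v $ k \<in> {1, 3}" "(k, h') \<in> insert (i, h) R"
    and i: "v $ i = 2 \<or> k = i" "(i, h) \<notin> R"
    and R: "\<And>j. j \<noteq> k \<Longrightarrow> v $ j \<noteq> 0 \<Longrightarrow> {j} \<times> UNIV \<subseteq> insert (i, h) R"
  shows "\<not> has_projectivity (half_fraction (generated_design (gen_matrix v)) (Some i, h) s)
           (Suc (card R))"
    (is "\<not> has_projectivity ?D _")
proof -
  let ?some = "\<lambda>(i, h). (Some i, h) :: 'n option \<times> gray_pos"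
  \<comment> \<open>The leading factor \<open>g\<close> will copy symbol \<open>h'\<close> of column
    \<open>k\<close>. Its required level is therefore chosen opposite to \<open>t k\<close>.\<close>
  obtain g where g: "\<And>x. gray_symbol g (x * v $ k) = gray_symbol h' x"
    using gray_symbol_mult_unit k by metis
  define t where "t j = (if j = i then s else 1)" for j
  let ?l = "\<lambda>c. case fst c of None \<Rightarrow> - t k | Some j \<Rightarrow> t j"
  show ?thesis
  proof (rule not_has_projectivityI[where S = "insert (None, g) (?some ` R)" and l = ?l])
    show "insert (None, g) (?some ` R) \<subseteq> factors ?D"
      using i by (auto simp: half_fraction_def generated_design_def)
    have "(None, g) \<notin> ?some ` R"
      by auto
    moreover have "card (?some ` R) = card R"
      by (simp add: card_image inj_on_def split_beta prod_eq_iff)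
    ultimately show "card (insert (None, g) (?some ` R)) = Suc (card R)"
      by simp
    show "?l c \<in> {1, -1}" for c :: "'n option \<times> gray_pos"
      using s by (auto simp: t_def split: option.split)
  next
    fix r assume "r \<in> runs ?D" and r: "\<forall>c\<in>insert (None, g) (?some ` R). level ?D r c = ?l c"
    then have "gray_symbol h (r $ i) = s"
      by (simp add: half_fraction_def level_generated)
    moreover have "gray_symbol a (r $ j) = t j" if "(j, a) \<in> R" for j a
      using bspec[OF r, of "(Some j, a)"] that
      by (force simp: half_fraction_def level_generated)
    ultimately have sym: "gray_symbol a (r $ j) = t j" if "(j, a) \<in> insert (i, h) R" for j a
      using that by (auto simp: t_def)
    \<comment> \<open>For \<open>j = i\<close> and \<open>s = -1\<close> the coordinate is 2 rather
      than 0, but then \<open>v $ i = 2\<close> because \<open>i\<close> differs from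
      \<open>k\<close>, and the product still vanishes.\<close>
    have zero: "r $ j * v $ j = 0" if "j \<noteq> k" for j
    proof (cases "v $ j = 0")
      case False
      then have "gray_symbol First (r $ j) = t j" "gray_symbol Second (r $ j) = t j"
        using R[OF that False] sym by blast+
      then show ?thesis
        using i \<open>j \<noteq> k\<close> Z4_cases[of "r $ j"] s
        by (cases "j = i") (auto simp: t_def gray_def)
    qed simp
    have "(\<Sum>j\<in>UNIV. r $ j * v $ j) = r $ k * v $ k"
      using zero by (simp add: sum.remove[of UNIV k])
    then have "gray_symbol g (\<Sum>j\<in>UNIV. r $ j * v $ j) = t k"
      using g sym k by metis
    moreover have "gray_symbol g (\<Sum>j\<in>UNIV. r $ j * v $ j) = - t k"
      using bspec[OF r, of "(None, g)"] by (simp add: half_fraction_def level_generated)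
    ultimately show False
      using s by (auto simp: t_def split: if_splits)
  qed auto
qed

section \<open>Counting factors and combining the bounds\<close>

lemma card_unit_cols: "card (unit_cols v) = 2 * (freq v 1 + freq v 3)"
proof -
  have "{i. v $ i \<in> {1, 3}} = {i. v $ i = 1} \<union> {i. v $ i = 3}"
    by auto
  then have "card {i. v $ i \<in> {1, 3}} = freq v 1 + freq v 3"
    unfolding freq_def by (simp only:) (rule card_Un_disjoint, auto)
  then show ?thesis
    by (simp only: card_cartesian_product card_gray_pos)
qed

lemma card_two_cols: "card (two_cols v) = 2 * freq v 2"
  by (simp add: freq_def card_gray_pos)

theorem theorem4:
  fixes v :: "4 ^ 'n"
    and D D' :: "(4 ^ 'n, 'n option \<times> gray_pos) design"
    and b :: "'n option \<times> gray_pos"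
    and s :: int
  assumes D: "D = generated_design (gen_matrix v)"
    and s: "s \<in> {1, -1}"
    and D': "D' = half_fraction D b s"
  shows "(freq v 2 > 0 \<and> freq v 1 + freq v 3 > 0 \<and> (associated v b 1 \<or> associated v b 3)
           \<longrightarrow> projectivity D' = 2 * (freq v 1 + freq v 3)) \<and>
         (freq v 2 = 0 \<and> freq v 1 + freq v 3 > 0 \<and> (associated v b 1 \<or> associated v b 3)
           \<longrightarrow> projectivity D' = 2 * (freq v 1 + freq v 3) - 2) \<and>
         (freq v 2 > 1 \<and> associated v b 2
           \<longrightarrow> projectivity D' = 2 * (freq v 1 + freq v 3) + 1) \<and>
         (freq v 2 = 1 \<and> freq v 1 + freq v 3 > 0 \<and> associated v b 2
           \<longrightarrow> projectivity D' = 2 * (freq v 1 + freq v 3))"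
proof (intro conjI impI; elim conjE)
  note cards = card_unit_cols[of v] card_two_cols[of v]
  have fin: "finite (factors D')"
    by simp
  have half: "D' = half_fraction (generated_design (gen_matrix v)) b s"
    using D D' by simp
  {
    assume "freq v 1 + freq v 3 > 0" "associated v b 1 \<or> associated v b 3"
    then obtain i h where b: "b = (Some i, h)" and vi: "v $ i \<in> {1, 3}"
      by (auto simp: associated_def)
    have ih: "(i, h) \<in> unit_cols v"
      using vi by simp
    \<comment> \<open>For \<open>freq v 2 > 0\<close> the second condition implies the first; for
      \<open>freq v 2 = 0\<close> the first is the stricter one and causes the loss of 2.\<close>
    have lower: "has_projectivity D' p"
      if "p + 2 \<le> 2 * (freq v 1 + freq v 3) + 2 * freq v 2" "p \<le> 2 * (freq v 1 + freq v 3)" for p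
      unfolding half b
      by (rule has_projectivity_half_fraction[OF s]) (use ih that cards in auto)
    {
      assume "freq v 2 > 0"
      have "card (unit_cols v - {(i, h)}) + 2 = Suc (2 * (freq v 1 + freq v 3))"
        using card_Suc_Diff1[OF _ ih] cards(1) by simp
      then have "\<not> has_projectivity D' (Suc (2 * (freq v 1 + freq v 3)))"
        using not_has_projectivity_parity[OF s, of v i h] unfolding half b by simp
      then show "projectivity D' = 2 * (freq v 1 + freq v 3)"
        using \<open>freq v 2 > 0\<close> by (intro projectivity_eqI[OF fin] lower) auto
    next
      assume "freq v 2 = 0"
      \<comment> \<open>Here \<open>k = i\<close>: both factors of the branching column are left out
        of \<open>R\<close>, and the branching symbol itself is the one copied by a leading
        factor.\<close>
      define R where "R = unit_cols v - {i} \<times> UNIV"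
      have no_two: "v $ j \<noteq> 2" for j
        using \<open>freq v 2 = 0\<close> by (auto simp: freq_def)
      have "card R = 2 * (freq v 1 + freq v 3) - 2"
        unfolding R_def cards(1)[symmetric]
        by (subst card_Diff_subset) (use vi in \<open>auto simp: card_gray_pos\<close>)
      moreover have "\<not> has_projectivity D' (Suc (card R))"
        unfolding half b
      proof (rule not_has_projectivity_aligned[OF s, of v i h])
        show "{j} \<times> UNIV \<subseteq> insert (i, h) R" if "j \<noteq> i" "v $ j \<noteq> 0" for j
          using that no_two[of j] Z4_cases[of "v $ j"] by (auto simp: R_def)
      qed (use vi in \<open>auto simp: R_def\<close>)
      ultimately show "projectivity D' = 2 * (freq v 1 + freq v 3) - 2"
        using \<open>freq v 1 + freq v 3 > 0\<close> \<open>freq v 2 = 0\<close>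
        by (intro projectivity_eqI[OF fin] lower) auto
    }
  next
    assume "associated v b 2"
    then obtain i h where b: "b = (Some i, h)" and vi: "v $ i = 2"
      by (auto simp: associated_def)
    have ih: "(i, h) \<in> two_cols v"
      using vi by simp
    \<comment> \<open>The first condition is the stricter one exactly when
      \<open>freq v 2 = 1\<close>; for larger \<open>freq v 2\<close> the second decides.\<close>
    have lower: "has_projectivity D' p"
      if "p + 2 \<le> 2 * (freq v 1 + freq v 3) + 2 * freq v 2"
        "p \<le> 2 * (freq v 1 + freq v 3) + 1" for p
      unfolding half b
      by (rule has_projectivity_half_fraction[OF s]) (use ih that cards in auto)
    {
      assume "freq v 2 > 1"
      \<comment> \<open>The branching factor is not a unit factor, so the dependent set of the
        parity argument keeps all unit factors and has one element more than for unit
        branching.\<close>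
      have "unit_cols v - {(i, h)} = unit_cols v"
        using vi by auto
      then have "card (unit_cols v - {(i, h)}) + 2 = Suc (2 * (freq v 1 + freq v 3) + 1)"
        using cards(1) by (simp only:)
      then have "\<not> has_projectivity D' (Suc (2 * (freq v 1 + freq v 3) + 1))"
        using not_has_projectivity_parity[OF s, of v i h] unfolding half b by metis
      then show "projectivity D' = 2 * (freq v 1 + freq v 3) + 1"
        using \<open>freq v 2 > 1\<close> by (intro projectivity_eqI[OF fin] lower) auto
    next
      assume "freq v 2 = 1" "freq v 1 + freq v 3 > 0"
      have "card (unit_cols v) > 0"
        using cards(1) \<open>freq v 1 + freq v 3 > 0\<close> by simp
      then obtain k where k: "v $ k \<in> {1, 3}"
        by (auto simp: card_gt_0_iff)
      \<comment> \<open>All factors with nonzero entry are used except the branching one and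
        \<open>(k, First)\<close>; \<open>(k, Second)\<close> stays and is copied by a leading
        factor. Since \<open>i\<close> is the only column with entry 2, the size is that of
        \<open>unit_cols v\<close>.\<close>
      define R where "R = unit_cols v \<union> two_cols v - {(i, h), (k, First)}"
      have two: "v $ j = 2 \<Longrightarrow> j = i" for j
        using \<open>freq v 2 = 1\<close> vi unfolding freq_def
        by (metis (mono_tags, lifting) card_1_singletonE mem_Collect_eq singletonD)
      have ki: "k \<noteq> i"
        using k vi by auto
      have "card R = card (unit_cols v \<union> two_cols v) - 2"
        unfolding R_def by (subst card_Diff_subset) (use k vi ki in auto)
      also have "card (unit_cols v \<union> two_cols v) = card (unit_cols v) + card (two_cols v)"
        by (rule card_Un_disjoint) auto
      finally have "card R = 2 * (freq v 1 + freq v 3)"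
        unfolding cards using \<open>freq v 2 = 1\<close> by simp
      moreover have "\<not> has_projectivity D' (Suc (card R))"
        unfolding half b
      proof (rule not_has_projectivity_aligned[OF s, of v k Second])
        show "{j} \<times> UNIV \<subseteq> insert (i, h) R" if "j \<noteq> k" "v $ j \<noteq> 0" for j
          using that two[of j] vi Z4_cases[of "v $ j"] by (auto simp: R_def)
      qed (use k vi ki in \<open>auto simp: R_def\<close>)
      ultimately show "projectivity D' = 2 * (freq v 1 + freq v 3)"
        using \<open>freq v 2 = 1\<close> by (intro projectivity_eqI[OF fin] lower) auto
    }
  }
qed

end
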